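(* For every nonempty connected graph $\Gamma$, \[\sum_{I\vdash\Gamma}(-1)^{|I|-1}|I|!\prod_{G\in I}\mathrm{HP}(\Gamma|_G)=(-1)^{|V_\Gamma|-1}\mathrm{HP}(\overline{\Gamma}),\] and, if $\Gamma$ moreover has at least one edge, \[\sum_{I\vdash\Gamma}(-1)^{|I|-1}(|I|-1)!\prod_{G\in I}\mathrm{HP}(\Gamma|_G)=\mathrm{HC}(\Gamma)+(-1)^{|V_\Gamma|-1}\mathrm{HC}(\overline{\Gamma}).\]
   Context: Graphs are finite, simple, undirected. $I\vdash\Gamma$ means $I$ is a partition of $V_\Gamma$ into blocks $G$ each inducing a connected subgraph $\Gamma|_G$; $|I|$ is the number of blocks. $\overline{\Gamma}$ is the complement graph (same vertices, complementary edges). $\mathrm{HP}(\Gamma)$ is the number of directed Hamiltonian paths of $\Gamma$, i.e. orderings $(v_1,\dots,v_n)$ of $V_\Gamma$ with $v_i$ adjacent to $v_{i+1}$ for all $i$ (so a one-vertex graph has $\mathrm{HP}=1$). $\mathrm{HC}(\Gamma)$ is the number of directed Hamiltonian cycles: for $|V_\Gamma|\ge3$, cyclic orderings $[v_1,\dots,v_n]$ (sequences up to rotation, not reflection) with consecutive vertices and $v_n,v_1$ adjacent; for a graph on two vertices, $\mathrm{HC}=1$ if they are adjacent and $0$ otherwise. *)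

theory Defs
  imports
    "Graph_Theory.Digraph_Component"
    "HOL-Library.Disjoint_Sets"
    "HOL-Combinatorics.Multiset_Permutations"
begin

text \<open>
  A finite simple undirected graph is a symmetric digraph in the sense of the locale
  \<^locale>\<open>graph\<close>: finite, loop-free, without parallel arcs, and with symmetric adjacency.
  An undirected edge is thus a pair of opposite arcs. Adjacency is \<^const>\<open>dominates\<close>.
  The library notion \<^const>\<open>Digraph_Component.connected\<close> includes nonemptiness.
\<close>

definition complement_graph :: "('a, 'b) pre_digraph \<Rightarrow> ('a, 'a \<times> 'a) pre_digraph" where
  "complement_graph G = with_proj
     \<lparr> pverts = verts G,
       parcs = {(u, v). u \<in> verts G \<and> v \<in> verts G \<and> u \<noteq> v \<and> \<not> u \<rightarrow>\<^bsub>G\<^esub> v} \<rparr>"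

lemma graph_complement_graph:
  assumes "graph G"
  shows "graph (complement_graph G)"
proof -
  interpret graph G by fact
  let ?H = "\<lparr> pverts = verts G,
    parcs = {(u, v). u \<in> verts G \<and> v \<in> verts G \<and> u \<noteq> v \<and> \<not> u \<rightarrow>\<^bsub>G\<^esub> v} \<rparr>"
  have "finite (parcs ?H)"
    by (rule finite_subset[of _ "verts G \<times> verts G"]) auto
  moreover have "symmetric (with_proj ?H)"
    by (auto simp: symmetric_def sym_def dest: graph_symmetric)
  ultimately have "pair_graph ?H"
    by unfold_locales auto
  then show ?thesis
    unfolding complement_graph_def by (rule pair_graph.pair_graphD_graph)
qed

definition connected_partitions :: "('a, 'b) pre_digraph \<Rightarrow> 'a set set set" where
  "connected_partitions G =
     {I. partition_on (verts G) I \<and> (\<forall>B\<in>I. Digraph_Component.connected (G \<restriction> B))}"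

definition ham_paths :: "('a, 'b) pre_digraph \<Rightarrow> 'a list set" where
  "ham_paths G = {vs \<in> permutations_of_set (verts G). successively (dominates G) vs}"

definition HP :: "('a, 'b) pre_digraph \<Rightarrow> nat" where
  "HP G = card (ham_paths G)"

definition closed_ham_paths :: "('a, 'b) pre_digraph \<Rightarrow> 'a list set" where
  "closed_ham_paths G = {vs \<in> ham_paths G. last vs \<rightarrow>\<^bsub>G\<^esub> hd vs}"

definition rotation_rel :: "'a list rel" where
  "rotation_rel = {(xs, ys). \<exists>n. ys = rotate n xs}"

lemma equiv_rotation_rel: "equiv UNIV (rotation_rel :: 'a list rel)"
proof (rule equivI)
  show "refl (rotation_rel :: 'a list rel)"
    unfolding rotation_rel_def refl_on_def by (auto intro: exI[of _ 0])
  show "sym (rotation_rel :: 'a list rel)"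
  proof (rule symI)
    fix xs ys :: "'a list"
    assume "(xs, ys) \<in> rotation_rel"
    then obtain n where n: "ys = rotate n xs"
      by (auto simp: rotation_rel_def)
    have "rotate (length xs - n mod length xs) (rotate (n mod length xs) xs) = xs"
    proof (cases "xs = []")
      case False
      then have "n mod length xs < length xs" by simp
      then show ?thesis by (simp add: rotate_rotate)
    qed simp
    then have "xs = rotate (length xs - n mod length xs) ys"
      by (simp add: n rotate_conv_mod[of n xs, symmetric])
    then show "(ys, xs) \<in> rotation_rel"
      by (auto simp: rotation_rel_def)
  qed
  show "trans (rotation_rel :: 'a list rel)"
    by (rule transI) (auto simp: rotation_rel_def rotate_rotate)
qed simp

text \<open>
  Directed Hamiltonian cycles: rotation classes (reflections are not identified).
  The value 0 on graphs with fewer than two vertices is a junk value.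
\<close>

definition HC :: "('a, 'b) pre_digraph \<Rightarrow> nat" where
  "HC G =
     (if card (verts G) \<ge> 3 then card (closed_ham_paths G // rotation_rel)
      else if card (verts G) = 2 \<and> (\<exists>u v. u \<rightarrow>\<^bsub>G\<^esub> v) then 1
      else 0)"

end

theory Submission
  imports Defs
begin

text \<open>
  Multiplying by \<open>|I|!\<close> orders the blocks, so the first sum runs over the ways of cutting an
  ordering of the vertices into consecutive paths, with a sign for the number of pieces. For a
  fixed ordering every non-edge has to be cut and every edge may be cut or not, so everything
  cancels unless the ordering has no edges at all, i.e. is a Hamiltonian path of the complement.

  For the factor \<open>(|I| - 1)!\<close> the block containing a fixed vertex \<open>r\<close> is put first, which amounts
  to cutting a cyclic ordering in at least one place. The same cancellation leaves the cyclic
  orderings without edges and, because the empty set of cuts is excluded, those with only edges.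
\<close>

section \<open>Splittings of an ordering into paths and their signed count\<close>

text \<open>An arbitrary relation \<open>R\<close> allows the same notion to serve for a graph, its
  induced subgraphs and its complement.\<close>

definition paths :: "('a \<Rightarrow> 'a \<Rightarrow> bool) \<Rightarrow> 'a set \<Rightarrow> 'a list set" where
  "paths R B = {xs \<in> permutations_of_set B. successively R xs}"

text \<open>Since empty pieces are excluded, a splitting amounts to a set of cuts between
  consecutive entries that contains every step violating \<open>R\<close>.\<close>

definition path_splits :: "('a \<Rightarrow> 'a \<Rightarrow> bool) \<Rightarrow> 'a list \<Rightarrow> 'a list list set" where
  "path_splits R vs = {xss. concat xss = vs \<and> [] \<notin> set xss \<and> (\<forall>xs\<in>set xss. successively R xs)}"

definition path_lists :: "('a \<Rightarrow> 'a \<Rightarrow> bool) \<Rightarrow> 'a set \<Rightarrow> 'a list list set" where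
  "path_lists R V = (\<Union>vs\<in>permutations_of_set V. path_splits R vs)"

lemma path_splits_Nil: "path_splits R [] = {[]}"
proof -
  have "xss = []" if "xss \<in> path_splits R []" for xss
    using that by (cases xss) (auto simp: path_splits_def)
  then show ?thesis
    by (auto simp: path_splits_def)
qed

text \<open>The first entry is either cut off as a block of its own or glued to the front of the
  first block of a splitting of the tail; gluing requires the step from \<open>x\<close> to
  \<open>hd ys\<close> to satisfy \<open>R\<close>.\<close>

lemma path_splits_Cons:
  "path_splits R (x # ys) = (#) [x] ` path_splits R ys \<union>
     (if ys \<noteq> [] \<and> R x (hd ys) then (\<lambda>xss. (x # hd xss) # tl xss) ` path_splits R ys else {})"
  (is "?L = ?A \<union> ?B")
proof (intro equalityI subsetI)
  fix xss assume xss: "xss \<in> ?L"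
  then have "xss \<noteq> []" "hd xss \<noteq> []"
    by (cases xss; auto simp: path_splits_def)+
  then obtain a as bss where [simp]: "xss = (a # as) # bss"
    by (metis list.exhaust_sel)
  have *: "a = x" "as @ concat bss = ys" "[] \<notin> set bss" "successively R (x # as)"
    "\<forall>xs\<in>set bss. successively R xs"
    using xss by (auto simp: path_splits_def)
  show "xss \<in> ?A \<union> ?B"
  proof (cases "as = []")
    case True
    then show ?thesis using * by (auto simp: path_splits_def)
  next
    case False
    then have "as # bss \<in> path_splits R ys" "ys \<noteq> [] \<and> R x (hd ys)"
      using * by (auto simp: path_splits_def successively_Cons)
    then show ?thesis
      using *(1) imageI[of "as # bss" "path_splits R ys" "\<lambda>xss. (x # hd xss) # tl xss"] by simp
  qed
next
  fix xss assume "xss \<in> ?A \<union> ?B"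
  then consider (A) yss where "yss \<in> path_splits R ys" "xss = [x] # yss"
    | (B) yss where "yss \<in> path_splits R ys" "ys \<noteq> []" "R x (hd ys)" "xss = (x # hd yss) # tl yss"
    by (auto split: if_splits)
  then show "xss \<in> ?L"
  proof cases
    case A
    then show ?thesis by (auto simp: path_splits_def)
  next
    case B
    then show ?thesis
      by (cases yss) (auto simp: path_splits_def successively_Cons)
  qed
qed

lemma finite_path_splits: "finite (path_splits R vs)"
  by (induction vs) (auto simp: path_splits_Nil path_splits_Cons)

text \<open>By induction on the list: if the first step satisfies \<open>R\<close>, cutting and
  gluing give splittings that differ by one block and cancel in pairs; otherwise the cut is forced
  and contributes a factor -1.\<close>

lemma sum_path_splits:
  "(\<Sum>xss\<in>path_splits R vs. (-1) ^ length xss) =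
     (if successively (\<lambda>x y. \<not> R x y) vs then (-1) ^ length vs else (0::int))"
proof (induction vs)
  case Nil
  then show ?case by (simp add: path_splits_Nil)
next
  case (Cons x ys)
  let ?g = "\<lambda>xss. (x # hd xss) # tl xss"
  show ?case
  proof (cases "ys \<noteq> [] \<and> R x (hd ys)")
    case True
    \<comment> \<open>These two facts make the gluing map injective, make it preserve the length,
      and keep its image apart from the splittings with first block \<open>[x]\<close>.\<close>
    have ne: "xss \<noteq> []" "hd xss \<noteq> []" if "xss \<in> path_splits R ys" for xss
    proof -
      show "xss \<noteq> []" using that True by (auto simp: path_splits_def)
      then show "hd xss \<noteq> []" using that by (cases xss) (auto simp: path_splits_def)
    qed
    have inj: "inj_on ?g (path_splits R ys)"
      by (rule inj_onI) (metis ne list.collapse list.inject)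
    have "(\<Sum>xss\<in>path_splits R (x # ys). (-1) ^ length xss) =
      (\<Sum>xss\<in>(#) [x] ` path_splits R ys. (-1) ^ length xss) +
      (\<Sum>xss\<in>?g ` path_splits R ys. (-1::int) ^ length xss)"
      using True ne by (simp add: path_splits_Cons) (subst sum.union_disjoint, auto simp: finite_path_splits, metis)
    also have "\<dots> = - (\<Sum>xss\<in>path_splits R ys. (-1) ^ length xss)
       + (\<Sum>xss\<in>path_splits R ys. (-1) ^ length (?g xss))"
      using inj by (subst (1 2) sum.reindex) (auto simp: sum_negf)
    also have "(\<Sum>xss\<in>path_splits R ys. (-1::int) ^ length (?g xss)) = (\<Sum>xss\<in>path_splits R ys. (-1) ^ length xss)"
      by (rule sum.cong) (use ne in \<open>auto simp flip: power_Suc simp: Suc_diff_1\<close>)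
    finally show ?thesis using True by (auto simp: successively_Cons)
  next
    case False
    then have "(\<Sum>xss\<in>path_splits R (x # ys). (-1) ^ length xss) =
      - (\<Sum>xss\<in>path_splits R ys. (-1::int) ^ length xss)"
      by (auto simp: path_splits_Cons sum.reindex sum_negf)
    then show ?thesis using Cons False by (auto simp: successively_Cons)
  qed
qed

section \<open>Lists of paths grouped by the partition of their vertex sets\<close>

lemma card_lists_over_blocks:
  assumes "\<forall>B\<in>set Bs. finite B"
  shows "card {xss. map set xss = Bs \<and> (\<forall>xs\<in>set xss. xs \<in> paths R (set xs))}
           = (\<Prod>B\<leftarrow>Bs. card (paths R B))"
    and "finite {xss. map set xss = Bs \<and> (\<forall>xs\<in>set xss. xs \<in> paths R (set xs))}"
  using assms
proof (induction Bs)
  case (Cons B Bs)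
  let ?S = "\<lambda>Bs. {xss. map set xss = Bs \<and> (\<forall>xs\<in>set xss. xs \<in> paths R (set xs))}"
  have eq: "?S (B # Bs) = (\<lambda>(xs, xss). xs # xss) ` (paths R B \<times> ?S Bs)"
    by (auto simp: Cons_eq_map_conv map_eq_Cons_conv image_iff paths_def permutations_of_set_def)
  { case 1
    then show ?case using Cons
      by (subst eq, subst card_image) (auto simp: inj_on_def card_cartesian_product)
  next
    case 2
    then show ?case using Cons by (subst eq) (auto simp: paths_def)
  }
qed (simp_all cong: conj_cong)

text \<open>\<open>K\<close> stands for the admissible orders of the blocks: all orders for the
  factor \<open>|I|!\<close>, those with the block of the root in front for
  \<open>(|I| - 1)!\<close>. The number of choices of paths is the same product for each
  order.\<close>

lemma card_lists_over_orderings: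
  assumes "finite I" "\<forall>B\<in>I. finite B" "K \<subseteq> permutations_of_set I"
  shows "card {xss. map set xss \<in> K \<and> (\<forall>xs\<in>set xss. xs \<in> paths R (set xs))}
           = card K * (\<Prod>B\<in>I. card (paths R B))"
proof -
  let ?S = "\<lambda>Bs. {xss. map set xss = Bs \<and> (\<forall>xs\<in>set xss. xs \<in> paths R (set xs))}"
  have K: "finite K" "\<And>Bs. Bs \<in> K \<Longrightarrow> set Bs = I \<and> distinct Bs"
    using finite_subset[OF assms(3)] assms(3) by (auto dest: permutations_of_setD)
  have "{xss. map set xss \<in> K \<and> (\<forall>xs\<in>set xss. xs \<in> paths R (set xs))} = (\<Union>Bs\<in>K. ?S Bs)"
    by auto
  also have "card \<dots> = (\<Sum>Bs\<in>K. card (?S Bs))"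
    by (rule card_UN_disjoint) (use K assms in \<open>auto intro!: card_lists_over_blocks(2)\<close>)
  also have "\<dots> = (\<Sum>Bs\<in>K. (\<Prod>B\<in>I. card (paths R B)))"
  proof (rule sum.cong)
    fix Bs assume "Bs \<in> K"
    then show "card (?S Bs) = (\<Prod>B\<in>I. card (paths R B))"
      using K(2)[of Bs] assms(2) card_lists_over_blocks(1)[of Bs R]
        prod.distinct_set_conv_list[of Bs "\<lambda>B. card (paths R B)"] by simp
  qed simp
  finally show ?thesis by simp
qed

text \<open>Cutting an ordering of \<open>V\<close> is the same as ordering a partition of
  \<open>V\<close> and choosing a path through each block: nonempty disjoint pieces have different
  vertex sets, and conversely distinct blocks of a partition are disjoint, so their paths
  concatenate without repetition.\<close>

lemma path_lists_altdef:
  "path_lists R V = {xss. partition_on V (set ` set xss) \<and> distinct (map set xss) \<and>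
                       (\<forall>xs\<in>set xss. xs \<in> paths R (set xs))}" (is "_ = ?P")
proof (intro equalityI subsetI)
  fix xss assume "xss \<in> path_lists R V"
  then have *: "set (concat xss) = V" "distinct (concat xss)" "[] \<notin> set xss"
    "\<forall>xs\<in>set xss. successively R xs"
    by (auto simp: path_lists_def path_splits_def permutations_of_set_def)
  have d: "distinct xss" "\<forall>xs\<in>set xss. distinct xs"
    "\<And>xs ys. xs \<in> set xss \<Longrightarrow> ys \<in> set xss \<Longrightarrow> xs \<noteq> ys \<Longrightarrow> set xs \<inter> set ys = {}"
    using *(2,3) by (auto simp: distinct_concat_iff removeAll_id)
  have "inj_on set (set xss)"
    by (rule inj_onI) (metis *(3) d(3) Int_absorb set_empty)
  then show "xss \<in> ?P"
    using * d(1,2) by (auto simp: partition_on_def distinct_map paths_def permutations_of_set_def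
        disjoint_def dest: d(3))
next
  fix xss assume "xss \<in> ?P"
  then have *: "partition_on V (set ` set xss)" "distinct xss" "inj_on set (set xss)"
    "\<And>xs. xs \<in> set xss \<Longrightarrow> distinct xs \<and> successively R xs"
    by (auto simp: paths_def permutations_of_set_def distinct_map)
  have ne: "[] \<notin> set xss"
    using *(1) by (force simp: partition_on_def)
  have "set xs \<inter> set ys = {}" if "xs \<in> set xss" "ys \<in> set xss" "xs \<noteq> ys" for xs ys
    using that *(1,3) unfolding partition_on_def disjoint_def
    by (metis image_eqI inj_onD)
  then have "distinct (concat xss)"
    using * ne by (auto simp: distinct_concat_iff removeAll_id)
  moreover have "set (concat xss) = V"
    using *(1) by (auto simp: partition_on_def)
  ultimately show "xss \<in> path_lists R V"
    using * ne by (auto simp: path_lists_def path_splits_def permutations_of_set_def)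
qed

lemma finite_path_lists: "finite V \<Longrightarrow> finite (path_lists R V)"
  by (auto simp: path_lists_def finite_path_splits)

text \<open>This turns sums over partitions into sums over lists of paths. The predicate
  \<open>Q\<close> restricts the order of the blocks, and the number of orders left becomes the
  factorial factor.\<close>

lemma sum_path_lists_by_partition:
  fixes c :: "nat \<Rightarrow> int"
  assumes "finite V"
  shows "(\<Sum>xss | xss \<in> path_lists R V \<and> Q (map set xss). c (length xss)) =
         (\<Sum>I | partition_on V I.
            int (card {Bs \<in> permutations_of_set I. Q Bs}) * c (card I) * (\<Prod>B\<in>I. int (card (paths R B))))"
proof -
  let ?X = "{xss. xss \<in> path_lists R V \<and> Q (map set xss)}"
  have fin: "finite ?X" "finite {I. partition_on V I}"
    using finite_path_lists[OF assms] finitely_many_partition_on[OF assms] by auto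
  have "(\<Sum>xss\<in>?X. c (length xss)) =
      (\<Sum>I | partition_on V I. \<Sum>xss | xss \<in> ?X \<and> set ` set xss = I. c (length xss))"
    by (rule sum.group[symmetric]) (use fin in \<open>auto simp: path_lists_altdef\<close>)
  also have "\<dots> = (\<Sum>I | partition_on V I.
            int (card {Bs \<in> permutations_of_set I. Q Bs}) * c (card I) * (\<Prod>B\<in>I. int (card (paths R B))))"
  proof (rule sum.cong)
    fix I assume "I \<in> {I. partition_on V I}"
    then have I: "partition_on V I" by simp
    let ?K = "{Bs \<in> permutations_of_set I. Q Bs}"
    \<comment> \<open>For fixed \<open>I\<close>, the partition and distinctness conditions together
      say that \<open>map set xss\<close> is an ordering of \<open>I\<close>.\<close>
    have eq: "{xss. xss \<in> ?X \<and> set ` set xss = I} =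
        {xss. map set xss \<in> ?K \<and> (\<forall>xs\<in>set xss. xs \<in> paths R (set xs))}"
      using I by (auto simp: path_lists_altdef permutations_of_set_def)
    have "(\<Sum>xss | xss \<in> ?X \<and> set ` set xss = I. c (length xss)) =
        (\<Sum>xss | xss \<in> ?X \<and> set ` set xss = I. c (card I))"
      by (rule sum.cong) (auto simp: path_lists_altdef dest: distinct_card)
    also have "\<dots> = int (card {xss. xss \<in> ?X \<and> set ` set xss = I}) * c (card I)"
      by simp
    also have "card {xss. xss \<in> ?X \<and> set ` set xss = I} = card ?K * (\<Prod>B\<in>I. card (paths R B))"
      unfolding eq
      by (rule card_lists_over_orderings)
        (use finite_elements[OF assms I] I assms in \<open>auto simp: partition_on_def dest: finite_subset[OF Union_upper]\<close>)
    finally show "(\<Sum>xss | xss \<in> ?X \<and> set ` set xss = I. c (length xss)) =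
        int (card ?K) * c (card I) * (\<Prod>B\<in>I. int (card (paths R B)))"
      by simp
  qed simp
  finally show ?thesis .
qed

section \<open>Cyclic orderings through a root\<close>

text \<open>The only splitting of a nonempty list with fewer than two blocks is \<open>[vs]\<close>,
  present exactly if \<open>vs\<close> is a path; leaving out its sign -1 adds 1. It corresponds to
  the cyclic ordering without any cut.\<close>

lemma sum_path_splits_ge_2:
  assumes "vs \<noteq> []"
  shows "(\<Sum>xss | xss \<in> path_splits R vs \<and> 2 \<le> length xss. (-1) ^ length xss) =
     (\<Sum>xss\<in>path_splits R vs. (-1) ^ length xss) + (if successively R vs then 1 else (0::int))"
proof -
  have "{xss \<in> path_splits R vs. \<not> 2 \<le> length xss} = (if successively R vs then {[vs]} else {})"
  proof -
    have "xss = [vs] \<and> successively R vs" if "xss \<in> path_splits R vs" "\<not> 2 \<le> length xss" for xss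
    proof -
      from that assms obtain xs where "xss = [xs]"
        by (cases xss; cases "tl xss") (auto simp: path_splits_def)
      with that show ?thesis by (auto simp: path_splits_def)
    qed
    with assms show ?thesis by (auto simp: path_splits_def)
  qed
  moreover have "(\<Sum>xss\<in>path_splits R vs. (-1::int) ^ length xss) =
      (\<Sum>xss | xss \<in> path_splits R vs \<and> 2 \<le> length xss. (-1) ^ length xss) +
      (\<Sum>xss | xss \<in> path_splits R vs \<and> \<not> 2 \<le> length xss. (-1) ^ length xss)"
    by (subst sum.union_disjoint[symmetric])
      (auto simp: finite_path_splits intro!: sum.cong)
  ultimately show ?thesis by simp
qed

text \<open>
  A first block \<open>as @ r # bs\<close> is broken up by moving \<open>as\<close> behind the last block: cyclic orderings
  are represented by the lists starting with \<open>r\<close>, and nonempty \<open>as\<close> means that their closing edge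
  is not cut.
\<close>

lemma sum_rotate_first_block:
  assumes "finite V" "r \<in> V"
  shows "(\<Sum>xss | xss \<in> path_lists R V \<and> r \<in> set (hd xss) \<and> hd (hd xss) \<noteq> r. (-1) ^ (length xss - 1)) =
    (\<Sum>vs | vs \<in> permutations_of_set V \<and> hd vs = r \<and> R (last vs) r.
       \<Sum>xss | xss \<in> path_splits R vs \<and> 2 \<le> length xss. (-1::int) ^ length xss)"
    (is "sum _ ?S = (\<Sum>vs\<in>?A. sum _ (?Z vs))")
proof -
  \<comment> \<open>\<open>?j\<close> cuts the first block in front of \<open>r\<close> and makes
    the part before \<open>r\<close> the last block; \<open>?i\<close> glues the last block back
    onto the first. The block count changes by one, which matches the exponents
    \<open>length xss - 1\<close> and \<open>length xss\<close> up to an even number.\<close>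
  let ?i = "\<lambda>xss. (last xss @ hd xss) # butlast (tl xss)"
  let ?j = "\<lambda>xss. dropWhile (\<lambda>v. v \<noteq> r) (hd xss) # tl xss @ [takeWhile (\<lambda>v. v \<noteq> r) (hd xss)]"
  have S: "?i (?j xss) = xss \<and> ?j xss \<in> (\<Union>vs\<in>?A. ?Z vs) \<and>
      (-1::int) ^ length (?j xss) = (-1) ^ (length xss - 1)"
    if xss: "xss \<in> ?S" for xss
  proof -
    have "xss \<noteq> []"
      using xss assms by (auto simp: path_lists_def path_splits_def permutations_of_set_def)
    moreover obtain as bs where "hd xss = as @ r # bs" "r \<notin> set as"
      using xss split_list_first[of r "hd xss"] by auto
    ultimately obtain yss where eq: "xss = (as @ r # bs) # yss" and r: "r \<notin> set as"
      by (metis list.collapse)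
    have "as \<noteq> []" using xss eq by auto
    have j: "?j xss = (r # bs) # yss @ [as]"
      using r by (auto simp: eq takeWhile_append dropWhile_append)
    \<comment> \<open>The step from the end of \<open>as\<close> to \<open>r\<close> inside the
      first block becomes the closing condition \<open>R (last vs) r\<close>.\<close>
    have "concat (?j xss) \<in> ?A" "?j xss \<in> ?Z (concat (?j xss))"
      unfolding j using xss \<open>as \<noteq> []\<close>
      by (auto simp: eq path_lists_def path_splits_def permutations_of_set_def successively_append_iff)
    then show ?thesis unfolding j by (auto simp: eq)
  qed
  have Z: "?j (?i xss) = xss \<and> ?i xss \<in> ?S" if xss: "xss \<in> (\<Union>vs\<in>?A. ?Z vs)" for xss
  proof -
    \<comment> \<open>Two blocks at least, so the last one is not the first and can be
      moved.\<close>
    obtain xs yss as where eq0: "xss = xs # yss @ [as]"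
      using xss by (cases xss; cases "tl xss" rule: rev_cases) auto
    then obtain bs where eq: "xss = (r # bs) # yss @ [as]"
      using xss by (cases xs) (auto simp: path_splits_def)
    have *: "as \<noteq> []" "r \<notin> set as"
      using xss by (auto simp: eq path_splits_def permutations_of_set_def)
    have i: "?i xss = (as @ r # bs) # yss" by (simp add: eq)
    have "?j (?i xss) = xss"
      unfolding i using * by (auto simp: eq takeWhile_append dropWhile_append)
    moreover have "hd as \<noteq> r" using * by (metis hd_in_set)
    then have "?i xss \<in> ?S"
      unfolding i using xss *
      by (auto simp: eq path_lists_def path_splits_def permutations_of_set_def successively_append_iff)
    ultimately show ?thesis by simp
  qed
  have "sum (\<lambda>xss. (-1::int) ^ (length xss - 1)) ?S = sum (\<lambda>xss. (-1) ^ length xss) (\<Union>vs\<in>?A. ?Z vs)"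
    by (rule sum.reindex_bij_witness[of _ ?i ?j]) (use S Z in blast)+
  also have "\<dots> = (\<Sum>vs\<in>?A. sum (\<lambda>xss. (-1) ^ length xss) (?Z vs))"
    by (rule sum.UNION_disjoint) (auto simp: finite_path_splits, auto simp: path_splits_def)
  finally show ?thesis .
qed

text \<open>The lists are separated by whether \<open>r\<close> starts its block, so that the
  closing step of the cyclic ordering is cut, or lies further inside, so that it is kept. The former
  come directly from orderings starting with \<open>r\<close>, the latter by
  \<open>sum_rotate_first_block\<close>.\<close>

lemma sum_rooted_path_lists:
  assumes "finite V" "r \<in> V"
  shows "(\<Sum>xss | xss \<in> path_lists R V \<and> r \<in> set (hd xss). (-1) ^ (length xss - 1)) =
     int (card {vs \<in> paths R V. hd vs = r \<and> R (last vs) r}) +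
     (-1) ^ (card V - 1) *
       int (card {vs \<in> paths (\<lambda>x y. \<not> R x y) V. hd vs = r \<and> \<not> R (last vs) r})"
proof -
  let ?A = "{vs \<in> permutations_of_set V. hd vs = r}"
  let ?F = "\<lambda>vs. \<Sum>xss\<in>path_splits R vs. (-1::int) ^ length xss"
  let ?S = "{xss. xss \<in> path_lists R V \<and> r \<in> set (hd xss) \<and> hd (hd xss) \<noteq> r}"
  let ?sgn = "\<lambda>xss. (-1::int) ^ (length xss - 1)"
  have A: "vs \<noteq> []" "length vs = card V" if "vs \<in> ?A" for vs
    using that assms by (auto simp: permutations_of_set_def distinct_card)
  have eq1: "{xss. xss \<in> path_lists R V \<and> r \<in> set (hd xss) \<and> hd (hd xss) = r} = (\<Union>vs\<in>?A. path_splits R vs)"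
    (is "?T = _")
  proof -
    have "hd (concat xss) = hd (hd xss)" "hd (hd xss) \<in> set (hd xss)"
      if "xss \<in> path_splits R vs" "vs \<in> permutations_of_set V" for xss vs
      using that assms by (cases xss; cases "hd xss"; auto simp: path_splits_def permutations_of_set_def)+
    then show ?thesis by (fastforce simp: path_lists_def path_splits_def)
  qed
  have "(\<Sum>xss | xss \<in> path_lists R V \<and> r \<in> set (hd xss). ?sgn xss) = sum ?sgn ?T + sum ?sgn ?S"
    by (subst sum.union_disjoint[symmetric])
      (auto simp: finite_path_lists[OF assms(1)] intro!: sum.cong)
  also have "sum ?sgn ?T = (\<Sum>vs\<in>?A. \<Sum>xss\<in>path_splits R vs. ?sgn xss)"
    unfolding eq1 by (rule sum.UNION_disjoint) (auto simp: finite_path_splits, auto simp: path_splits_def)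
  also have "\<dots> = (\<Sum>vs\<in>?A. - ?F vs)"
  proof (rule sum.cong)
    fix vs assume "vs \<in> ?A"
    \<comment> \<open>Nonemptiness makes the truncated subtraction in \<open>length xss - 1\<close>
      exact, so the shift only flips the sign.\<close>
    then have "xss \<noteq> []" if "xss \<in> path_splits R vs" for xss
      using A(1)[of vs] that by (auto simp: path_splits_def)
    then have "?sgn xss = - ((-1) ^ length xss)" if "xss \<in> path_splits R vs" for xss
      using that by (cases xss) auto
    then show "(\<Sum>xss\<in>path_splits R vs. ?sgn xss) = - ?F vs"
      by (simp add: sum_negf)
  qed simp
  also have "sum ?sgn ?S =
      (\<Sum>vs\<in>?A. if R (last vs) r then ?F vs + (if successively R vs then 1 else 0) else 0)"
  proof -
    have "sum ?sgn ?S = (\<Sum>vs | vs \<in> permutations_of_set V \<and> hd vs = r \<and> R (last vs) r.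
        ?F vs + (if successively R vs then 1 else 0))"
      unfolding sum_rotate_first_block[OF assms]
      by (intro sum.cong refl sum_path_splits_ge_2 A(1)) simp
    then show ?thesis
      by (simp add: sum.inter_filter[symmetric] conj_ac)
  qed
  \<comment> \<open>Ordering by ordering: if the closing step satisfies \<open>R\<close>, the two
    copies of \<open>?F vs\<close> cancel and the indicator of an uncut cycle remains; if not,
    \<open>- ?F vs\<close> remains and vanishes unless no step satisfies \<open>R\<close>.\<close>
  also have "(\<Sum>vs\<in>?A. - ?F vs) + \<dots> = (\<Sum>vs\<in>?A.
      (if successively R vs \<and> R (last vs) r then 1 else 0) +
      (-1) ^ (card V - 1) * (if successively (\<lambda>x y. \<not> R x y) vs \<and> \<not> R (last vs) r then 1 else 0))"
    unfolding sum.distrib[symmetric]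
  proof (rule sum.cong)
    fix vs assume "vs \<in> ?A"
    then have "(-1::int) ^ length vs = - ((-1) ^ (card V - 1))"
      using A[of vs] by (cases vs) (auto dest!: sym[of _ "card V"])
    then show "- ?F vs + (if R (last vs) r then ?F vs + (if successively R vs then 1 else 0) else 0) =
      (if successively R vs \<and> R (last vs) r then 1 else 0) +
      (-1) ^ (card V - 1) * (if successively (\<lambda>x y. \<not> R x y) vs \<and> \<not> R (last vs) r then 1 else 0)"
      unfolding sum_path_splits by auto
  qed simp
  also have "\<dots> = int (card {vs \<in> ?A. successively R vs \<and> R (last vs) r}) +
     (-1) ^ (card V - 1) * int (card {vs \<in> ?A. successively (\<lambda>x y. \<not> R x y) vs \<and> \<not> R (last vs) r})"
    by (simp add: sum.distrib sum_distrib_left[symmetric] sum.inter_filter[symmetric])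
  finally show ?thesis
    by (simp add: paths_def conj_ac)
qed

section \<open>Linear orderings and the number of block orders\<close>

text \<open>Each list of paths belongs to the single ordering it concatenates to, so
  \<open>sum_path_splits\<close> applies to every ordering separately. As \<open>V\<close> is
  nonempty, lowering the exponent by one flips the sign on both sides.\<close>

lemma sum_signed_path_lists:
  assumes "finite V" "V \<noteq> {}"
  shows "(\<Sum>xss\<in>path_lists R V. (-1) ^ (length xss - 1)) =
     (-1) ^ (card V - 1) * int (card (paths (\<lambda>x y. \<not> R x y) V))"
proof -
  have len: "length vs = card V" if "vs \<in> permutations_of_set V" for vs
    using that by (rule length_finite_permutations_of_set)
  have pos: "0 < card V" using assms by (simp add: card_gt_0_iff)
  have sgn: "(-1::int) ^ (n - 1) = - ((-1) ^ n)" if "0 < n" for n :: nat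
    using that by (cases n) auto
  have "(\<Sum>xss\<in>path_lists R V. (-1) ^ (length xss - 1)) =
      (\<Sum>vs\<in>permutations_of_set V. \<Sum>xss\<in>path_splits R vs. (-1::int) ^ (length xss - 1))"
    unfolding path_lists_def
    by (rule sum.UNION_disjoint) (auto simp: finite_path_splits, auto simp: path_splits_def)
  also have "\<dots> = (\<Sum>vs\<in>permutations_of_set V. - (\<Sum>xss\<in>path_splits R vs. (-1) ^ length xss))"
    unfolding sum_negf[symmetric]
  proof (intro sum.cong refl sgn)
    fix vs xss assume "vs \<in> permutations_of_set V" "xss \<in> path_splits R vs"
    then show "0 < length xss"
      using assms(2) by (auto simp: path_splits_def permutations_of_set_def)
  qed
  also have "\<dots> = (\<Sum>vs\<in>permutations_of_set V.
      (-1) ^ (card V - 1) * (if successively (\<lambda>x y. \<not> R x y) vs then 1 else 0))"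
    by (rule sum.cong) (simp_all add: sum_path_splits len sgn[OF pos] del: One_nat_def)
  finally show ?thesis
    by (simp add: sum_distrib_left[symmetric] sum.inter_filter[symmetric] paths_def)
qed

text \<open>The block containing \<open>r\<close> is unique and must come first; the remaining
  blocks follow in any order.\<close>

lemma card_orderings_hd_block:
  assumes "finite V" "partition_on V I" "r \<in> V"
  shows "card {Bs \<in> permutations_of_set I. r \<in> hd Bs} = fact (card I - 1)"
proof -
  obtain B where B: "B \<in> I" "r \<in> B" and uniq: "\<And>B'. B' \<in> I \<Longrightarrow> r \<in> B' \<Longrightarrow> B' = B"
    using assms(2,3) unfolding partition_on_def disjoint_def by (metis IntI UnionE empty_iff)
  have fin: "finite I" by (rule finite_elements[OF assms(1,2)])
  have "{Bs \<in> permutations_of_set I. r \<in> hd Bs} = (#) B ` permutations_of_set (I - {B})"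
  proof (intro equalityI subsetI)
    fix Bs assume Bs: "Bs \<in> {Bs \<in> permutations_of_set I. r \<in> hd Bs}"
    then have ne: "Bs \<noteq> []" using B(1) by (auto simp: permutations_of_set_def)
    with Bs have "hd Bs = B" by (intro uniq) (auto simp: permutations_of_set_def)
    with ne obtain Cs where Cs: "Bs = B # Cs" by (cases Bs) auto
    with Bs have "Cs \<in> permutations_of_set (I - {B})"
      by (auto simp: permutations_of_set_def)
    with Cs show "Bs \<in> (#) B ` permutations_of_set (I - {B})" by simp
  next
    fix Bs assume "Bs \<in> (#) B ` permutations_of_set (I - {B})"
    then obtain Cs where "Bs = B # Cs" "set Cs = I - {B}" "distinct Cs"
      by (auto dest: permutations_of_setD)
    with B show "Bs \<in> {Bs \<in> permutations_of_set I. r \<in> hd Bs}"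
      by (simp add: permutations_of_set_def insert_absorb)
  qed
  then show ?thesis
    using B(1) fin by (simp add: card_image)
qed

section \<open>Translation to induced subgraphs, complements and connectedness\<close>

lemma dominates_induce_subgraph_iff:
  "u \<rightarrow>\<^bsub>G \<restriction> B\<^esub> v \<longleftrightarrow> u \<in> B \<and> v \<in> B \<and> u \<rightarrow>\<^bsub>G\<^esub> v"
  by (auto simp: arcs_ends_conv)

lemma dominates_complement_graph_iff:
  "u \<rightarrow>\<^bsub>complement_graph G\<^esub> v \<longleftrightarrow> u \<in> verts G \<and> v \<in> verts G \<and> u \<noteq> v \<and> \<not> u \<rightarrow>\<^bsub>G\<^esub> v"
  by (simp add: complement_graph_def)

lemma verts_complement_graph: "verts (complement_graph G) = verts G"
  by (simp add: complement_graph_def)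

lemma ham_paths_eq_paths: "ham_paths G = paths (dominates G) (verts G)"
  by (simp add: ham_paths_def paths_def)

lemma ham_paths_induce_subgraph: "ham_paths (G \<restriction> B) = paths (dominates G) B"
  unfolding ham_paths_def paths_def induce_subgraph_verts
  by (auto simp: dominates_induce_subgraph_iff permutations_of_set_def cong: successively_cong)

lemma successively_distinct_iff:
  assumes "distinct xs"
  shows "successively (\<lambda>x y. x \<noteq> y \<and> R x y) xs \<longleftrightarrow> successively R xs"
  using assms by (induction xs) (auto simp: successively_Cons)

text \<open>Adjacency in the complement also demands different endpoints, which consecutive entries
  of a distinct list always have.\<close>

lemma ham_paths_complement_graph:
  "ham_paths (complement_graph G) = paths (\<lambda>x y. \<not> x \<rightarrow>\<^bsub>G\<^esub> y) (verts G)"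
proof -
  have "successively (dominates (complement_graph G)) vs \<longleftrightarrow> successively (\<lambda>x y. \<not> x \<rightarrow>\<^bsub>G\<^esub> y) vs"
    if "vs \<in> permutations_of_set (verts G)" for vs
  proof -
    have "successively (dominates (complement_graph G)) vs \<longleftrightarrow>
        successively (\<lambda>x y. x \<noteq> y \<and> \<not> x \<rightarrow>\<^bsub>G\<^esub> y) vs"
      using that by (intro successively_cong) (auto simp: dominates_complement_graph_iff permutations_of_set_def)
    then show ?thesis
      using that successively_distinct_iff[of vs "\<lambda>x y. \<not> x \<rightarrow>\<^bsub>G\<^esub> y"] by (simp add: permutations_of_set_def)
  qed
  then show ?thesis
    by (auto simp: ham_paths_def paths_def verts_complement_graph)
qed

lemma (in wf_digraph) successively_dominates_reachable:
  assumes "successively (dominates G) xs" "set xs \<subseteq> verts G" "v \<in> set xs"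
  shows "hd xs \<rightarrow>\<^sup>* v"
  using assms
proof (induction xs)
  case (Cons x xs)
  show ?case
  proof (cases "v = x")
    case False
    with Cons have "hd xs \<rightarrow>\<^sup>* v" "x \<rightarrow>\<^bsub>G\<^esub> hd xs" by (auto simp: successively_Cons)
    then show ?thesis by (auto intro: adj_reachable_trans)
  qed (use Cons in auto)
qed simp

text \<open>All vertices are reachable from the head of the path, hence by symmetry from one
  another.\<close>

lemma (in sym_digraph) connected_if_ham_path:
  assumes "xs \<in> ham_paths G" "verts G \<noteq> {}"
  shows "Digraph_Component.connected G"
  unfolding Digraph_Component.connected_def
proof (rule strongly_connectedI)
  show "verts (with_proj (mk_symmetric G)) \<noteq> {}" using assms by simp
next
  fix u v assume "u \<in> verts (with_proj (mk_symmetric G))" "v \<in> verts (with_proj (mk_symmetric G))"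
  then have "hd xs \<rightarrow>\<^sup>* u" "hd xs \<rightarrow>\<^sup>* v"
    using assms by (auto intro!: successively_dominates_reachable simp: ham_paths_def permutations_of_set_def)
  then have "u \<rightarrow>\<^sup>* v" by (blast intro: symmetric_reachable' reachable_trans)
  then show "u \<rightarrow>\<^sup>*\<^bsub>with_proj (mk_symmetric G)\<^esub> v" by (rule reachable_mk_symmetricI)
qed

text \<open>A disconnected block has no Hamiltonian path and makes the product vanish, so the sum
  may be extended to all partitions of the vertex set.\<close>

lemma sum_connected_partitions:
  fixes c :: "nat \<Rightarrow> int"
  assumes "graph G"
  shows "(\<Sum>I\<in>connected_partitions G. c (card I) * (\<Prod>B\<in>I. int (HP (G \<restriction> B)))) =
         (\<Sum>I | partition_on (verts G) I. c (card I) * (\<Prod>B\<in>I. int (card (paths (dominates G) B))))"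
proof -
  interpret graph G by fact
  have "(\<Prod>B\<in>I. int (HP (G \<restriction> B))) = 0" if I: "partition_on (verts G) I" "I \<notin> connected_partitions G" for I
  proof -
    from I obtain B where B: "B \<in> I" "\<not> Digraph_Component.connected (G \<restriction> B)"
      by (auto simp: connected_partitions_def)
    have "B \<subseteq> verts G" "B \<noteq> {}" using B(1) I(1) by (auto simp: partition_on_def)
    then interpret B: sym_digraph "G \<restriction> B"
      by (intro induced_graph_imp_graph induced_induce)
    have "ham_paths (G \<restriction> B) = {}"
      using B.connected_if_ham_path B(2) \<open>B \<noteq> {}\<close> by auto
    then show ?thesis
      using B(1) finite_elements[OF finite_verts I(1)] by (auto simp: HP_def intro!: prod_zero bexI[of _ B])
  qed
  then have "(\<Sum>I\<in>connected_partitions G. c (card I) * (\<Prod>B\<in>I. int (HP (G \<restriction> B)))) =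
      (\<Sum>I | partition_on (verts G) I. c (card I) * (\<Prod>B\<in>I. int (HP (G \<restriction> B))))"
    by (intro sum.mono_neutral_left finitely_many_partition_on) (auto simp: connected_partitions_def)
  then show ?thesis
    by (simp add: HP_def ham_paths_induce_subgraph)
qed

section \<open>Hamiltonian cycles as closed paths starting at a root\<close>

lemma rotate_closed_ham_paths:
  assumes "vs \<in> closed_ham_paths G"
  shows "rotate n vs \<in> closed_ham_paths G"
proof (induction n)
  case (Suc n)
  then show ?case
    by (cases "rotate n vs")
      (auto split: if_splits simp: closed_ham_paths_def ham_paths_def permutations_of_set_def
        successively_append_iff successively_Cons hd_append)
qed (use assms in simp)

lemma rotate_eq_if_hd_eq:
  assumes "distinct xs" "hd (rotate n xs) = hd xs"
  shows "rotate n xs = xs"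
proof (cases "xs = []")
  case False
  then have "xs ! (n mod length xs) = xs ! 0"
    using assms(2) hd_rotate_conv_nth[of xs n] hd_conv_nth[of xs] by simp
  with False have "n mod length xs = 0"
    using assms(1) by (simp add: nth_eq_iff_index_eq)
  then show ?thesis by (simp add: rotate_conv_mod[of n])
qed simp

text \<open>As \<open>r\<close> occurs exactly once in each list, every rotation class has exactly
  one member starting with \<open>r\<close>.\<close>

lemma card_rotation_classes:
  assumes "r \<in> verts G"
  shows "card (closed_ham_paths G // rotation_rel) = card {vs \<in> closed_ham_paths G. hd vs = r}"
    (is "_ = card ?C")
proof -
  let ?f = "\<lambda>vs :: 'a list. rotation_rel `` {vs}"
  have "inj_on ?f ?C"
  proof (rule inj_onI)
    fix vs ws assume *: "vs \<in> ?C" "ws \<in> ?C" "?f vs = ?f ws"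
    then have "(vs, ws) \<in> rotation_rel"
      by (simp add: eq_equiv_class_iff[OF equiv_rotation_rel])
    then obtain n where "ws = rotate n vs" by (auto simp: rotation_rel_def)
    with * rotate_eq_if_hd_eq[of vs n] show "vs = ws"
      by (auto simp: closed_ham_paths_def ham_paths_def permutations_of_set_def)
  qed
  moreover have "?f ` ?C = closed_ham_paths G // rotation_rel"
  proof (intro equalityI subsetI)
    fix X assume "X \<in> closed_ham_paths G // rotation_rel"
    then obtain vs where vs: "vs \<in> closed_ham_paths G" "X = ?f vs"
      by (auto elim: quotientE)
    then have "r \<in> set vs"
      using assms by (auto simp: closed_ham_paths_def ham_paths_def permutations_of_set_def)
    then obtain as bs where "vs = as @ r # bs" by (auto simp: in_set_conv_decomp)
    then have "hd (rotate (length as) vs) = r" by (simp add: rotate_append)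
    moreover have "?f vs = ?f (rotate (length as) vs)"
      by (rule equiv_class_eq[OF equiv_rotation_rel]) (auto simp: rotation_rel_def)
    ultimately show "X \<in> ?f ` ?C"
      using vs rotate_closed_ham_paths[of vs G "length as"] by auto
  qed (auto intro: quotientI)
  ultimately show ?thesis by (metis card_image)
qed

text \<open>From three vertices on this is \<open>card_rotation_classes\<close>. On two vertices the
  convention for \<open>HC\<close> agrees with the rooted count: the only candidate
  \<open>[r, s]\<close> closes up along its own edge traversed backwards.\<close>

lemma HC_eq_card_rooted:
  assumes "graph G" "2 \<le> card (verts G)" "r \<in> verts G"
  shows "HC G = card {vs \<in> closed_ham_paths G. hd vs = r}"
proof (cases "card (verts G) = 2")
  case False
  with assms show ?thesis by (simp add: HC_def card_rotation_classes)
next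
  case True
  interpret graph G by fact
  obtain s where V: "verts G = {r, s}" "r \<noteq> s"
    using True assms(3) by (auto simp: card_2_iff doubleton_eq_iff)
  have adj: "(\<exists>u v. u \<rightarrow>\<^bsub>G\<^esub> v) \<longleftrightarrow> r \<rightarrow>\<^bsub>G\<^esub> s"
    using V by (metis adj_in_verts adj_not_same graph_symmetric insertE singletonD)
  have rooted: "vs \<in> permutations_of_set {r, s} \<and> hd vs = r \<longleftrightarrow> vs = [r, s]" for vs
    using V(2) by (simp add: permutations_of_set_doubleton) (metis list.sel(1))
  have "{vs \<in> closed_ham_paths G. hd vs = r} =
      {vs. (vs \<in> permutations_of_set {r, s} \<and> hd vs = r) \<and>
           successively (dominates G) vs \<and> last vs \<rightarrow>\<^bsub>G\<^esub> hd vs}"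
    by (auto simp: closed_ham_paths_def ham_paths_def V(1))
  also have "\<dots> = (if r \<rightarrow>\<^bsub>G\<^esub> s then {[r, s]} else {})"
    unfolding rooted using graph_symmetric by auto
  finally have "{vs \<in> closed_ham_paths G. hd vs = r} = (if r \<rightarrow>\<^bsub>G\<^esub> s then {[r, s]} else {})" .
  then show ?thesis
    by (simp add: HC_def True adj)
qed

section \<open>Both partition identities from the signed sums\<close>

theorem theorem5p1p2:
  fixes G :: "('a, 'b) pre_digraph"
  assumes "graph G"
    and "verts G \<noteq> {}"
    and "Digraph_Component.connected G"
  shows "(\<Sum>I\<in>connected_partitions G.
            (-1) ^ (card I - 1) * fact (card I) * (\<Prod>B\<in>I. int (HP (G \<restriction> B))))
          = (-1) ^ (card (verts G) - 1) * int (HP (complement_graph G))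
    \<and> (arcs G \<noteq> {} \<longrightarrow>
         (\<Sum>I\<in>connected_partitions G.
            (-1) ^ (card I - 1) * fact (card I - 1) * (\<Prod>B\<in>I. int (HP (G \<restriction> B))))
          = int (HC G) + (-1) ^ (card (verts G) - 1) * int (HC (complement_graph G)))"
proof (intro conjI impI)
  interpret graph G by fact
  let ?V = "verts G" and ?R = "dominates G"
  let ?paths = "\<lambda>I. \<Prod>B\<in>I. int (card (paths ?R B))"
  have "(\<Sum>I\<in>connected_partitions G.
            (-1) ^ (card I - 1) * fact (card I) * (\<Prod>B\<in>I. int (HP (G \<restriction> B)))) =
      (\<Sum>I | partition_on ?V I. (-1) ^ (card I - 1) * fact (card I) * ?paths I)"
    by (rule sum_connected_partitions[OF assms(1)])
  also have "\<dots> = (\<Sum>xss | xss \<in> path_lists ?R ?V \<and> True. (-1) ^ (length xss - 1))"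
    unfolding sum_path_lists_by_partition[OF finite_verts, where Q = "\<lambda>_. True" and c = "\<lambda>k. (-1) ^ (k - 1)"]
    by (rule sum.cong) (auto simp: finite_elements[OF finite_verts])
  also have "\<dots> = (-1) ^ (card ?V - 1) * int (HP (complement_graph G))"
    using sum_signed_path_lists[OF finite_verts assms(2), of ?R]
    by (simp add: HP_def ham_paths_complement_graph)
  finally show "(\<Sum>I\<in>connected_partitions G.
            (-1) ^ (card I - 1) * fact (card I) * (\<Prod>B\<in>I. int (HP (G \<restriction> B)))) =
      (-1) ^ (card ?V - 1) * int (HP (complement_graph G))" .

  assume "arcs G \<noteq> {}"
  \<comment> \<open>The edge supplies the root \<open>r\<close> and a second vertex, as
    \<open>HC_eq_card_rooted\<close> requires for \<open>G\<close> and for its complement.\<close>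
  then obtain r s where "r \<rightarrow>\<^bsub>G\<^esub> s" by (auto simp: arcs_ends_conv)
  then have rs: "r \<in> ?V" "s \<in> ?V" "r \<noteq> s" by (auto dest: adj_not_same)
  then have card: "2 \<le> card ?V"
    using card_mono[OF finite_verts, of "{r, s}"] by simp
  \<comment> \<open>With two vertices or more the closing step joins different vertices, so for it
    non-adjacency in \<open>G\<close> is the same as adjacency in the complement.\<close>
  have hd_last: "last vs \<noteq> hd vs" "last vs \<in> ?V" if "vs \<in> permutations_of_set ?V" for vs
  proof -
    have vs: "distinct vs" "set vs = ?V" "2 \<le> length vs"
      using that card length_finite_permutations_of_set[OF that] by (auto dest: permutations_of_setD)
    then obtain v w ws where "vs = v # w # ws"
      by (cases vs; cases "tl vs") auto
    with vs(1) last_in_set[of "w # ws"] show "last vs \<noteq> hd vs" by auto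
    from vs(2,3) last_in_set[of vs] show "last vs \<in> ?V" by force
  qed
  have HC: "HC G = card {vs \<in> paths ?R ?V. hd vs = r \<and> ?R (last vs) r}"
    unfolding HC_eq_card_rooted[OF assms(1) card rs(1)] closed_ham_paths_def ham_paths_eq_paths
    by (rule arg_cong[of _ _ card]) auto
  have HC_compl: "HC (complement_graph G) =
      card {vs \<in> paths (\<lambda>x y. \<not> ?R x y) ?V. hd vs = r \<and> \<not> ?R (last vs) r}"
    using HC_eq_card_rooted[of "complement_graph G" r] graph_complement_graph[OF assms(1)] card rs(1) hd_last
    by (auto simp: verts_complement_graph closed_ham_paths_def ham_paths_complement_graph
        dominates_complement_graph_iff paths_def intro!: arg_cong[of _ _ card])
  \<comment> \<open>The lists are nonempty here, so \<open>hd\<close> is specified and commutes with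
    \<open>map set\<close>.\<close>
  have hd_map: "r \<in> set (hd xss) \<longleftrightarrow> r \<in> hd (map set xss)" if "xss \<in> path_lists ?R ?V" for xss
    using that assms(2) by (cases xss) (auto simp: path_lists_def path_splits_def permutations_of_set_def)
  have "(\<Sum>I\<in>connected_partitions G.
            (-1) ^ (card I - 1) * fact (card I - 1) * (\<Prod>B\<in>I. int (HP (G \<restriction> B)))) =
      (\<Sum>I | partition_on ?V I. (-1) ^ (card I - 1) * fact (card I - 1) * ?paths I)"
    by (rule sum_connected_partitions[OF assms(1)])
  \<comment> \<open>Demanding the block of \<open>r\<close> in front leaves
    \<open>fact (card I - 1)\<close> orders of \<open>I\<close>.\<close>
  also have "\<dots> = (\<Sum>xss | xss \<in> path_lists ?R ?V \<and> r \<in> hd (map set xss). (-1) ^ (length xss - 1))"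
    unfolding sum_path_lists_by_partition[OF finite_verts, where Q = "\<lambda>Bs. r \<in> hd Bs" and c = "\<lambda>k. (-1) ^ (k - 1)"]
    by (rule sum.cong) (auto simp: card_orderings_hd_block[OF finite_verts _ rs(1)])
  also have "\<dots> = (\<Sum>xss | xss \<in> path_lists ?R ?V \<and> r \<in> set (hd xss). (-1) ^ (length xss - 1))"
    using hd_map by (intro sum.cong) auto
  also have "\<dots> = int (HC G) + (-1) ^ (card ?V - 1) * int (HC (complement_graph G))"
    unfolding HC HC_compl by (rule sum_rooted_path_lists[OF finite_verts rs(1)])
  finally show "(\<Sum>I\<in>connected_partitions G.
            (-1) ^ (card I - 1) * fact (card I - 1) * (\<Prod>B\<in>I. int (HP (G \<restriction> B)))) =
      int (HC G) + (-1) ^ (card ?V - 1) * int (HC (complement_graph G))" .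
qed

end
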